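(* Let $\mathcal{X}$ be a finite state space, $\pi$ a probability mass function on $\mathcal{X}$ with full support, $P \in \mathcal{L}(\pi)$ ergodic, and $Q \in \mathcal{I}(\pi) \cap \mathcal{L}$. For $\alpha \in [0,1]$ let $\overline{P}_{\alpha}(Q) := \alpha P + (1-\alpha) QPQ$, and let $\overline{P}(Q):=\frac12(P+QPQ)$. For any $f \in \ell^2_0(\pi)$ and $\alpha\in[0,1]$, $$ v(f,\overline{P}_\alpha(Q)) \leq \alpha v(f,P) + (1-\alpha) v(Qf,P). $$ In particular, if $f$ satisfies $Qf = f$ or $Qf=-f$, then for every $\alpha\in[0,1]$ $$ v(f,\overline{P}_\alpha(Q)) \leq v(f,P), $$ and hence $$ \min_{\alpha \in [0,1]} v(f,\overline{P}_\alpha(Q)) = v(f,\overline{P}(Q)). $$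
   Context: $\mathcal{L}$ is the set of transition (row-stochastic) matrices on $\mathcal{X}$; $\mathcal{L}(\pi)$ is the set of $\pi$-reversible ones, i.e. $\pi(x)P(x,y)=\pi(y)P(y,x)$ for all $x,y$. Ergodic means irreducible and aperiodic. For a matrix $M$, $M^*(x,y)=\frac{\pi(y)}{\pi(x)}M(y,x)$. $\mathcal{I}(\pi)$ is the set of real matrices $Q$ with $Q^2=I$ and $Q^*=Q$. $\langle f,g\rangle_\pi=\sum_x f(x)g(x)\pi(x)$ and $\ell^2_0(\pi)=\{f:\mathcal{X}\to\mathbb{R}: \sum_x\pi(x)f(x)=0\}$. For an ergodic $P$ with stationary distribution $\pi$, with $\Pi$ the matrix whose rows all equal $\pi$, the fundamental matrix is $Z(P):=(I-(P-\Pi))^{-1}$ and the asymptotic variance of $f\in\ell^2_0(\pi)$ is $v(f,P):=2\langle f,Z(P)f\rangle_\pi-\langle f,f\rangle_\pi$ (which equals $\lim_{n\to\infty}\frac1n\mathrm{Var}_\mu(\sum_{i=1}^n f(X_i))$ for the chain $(X_n)$ with transition matrix $P$ and any initial law $\mu$). *)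

theory Defs
  imports "HOL-Analysis.Analysis" "HOL-Probability.Probability_Mass_Function"
begin

text \<open>The finite state space is a type \<open>'a::finite\<close>, so that \<open>P $ x $ y\<close> is the entry
  \<open>P(x,y)\<close> and \<open>P *v f\<close> is \<open>x \<mapsto> (\<Sum>y. P(x,y) f(y))\<close>.\<close>

definition transition_matrices :: "(real ^ 'a ^ 'a::finite) set" where
  "transition_matrices = {P. (\<forall>x y. 0 \<le> P $ x $ y) \<and> (\<forall>x. (\<Sum>y\<in>UNIV. P $ x $ y) = 1)}"

definition reversible_matrices :: "'a::finite pmf \<Rightarrow> (real ^ 'a ^ 'a) set" where
  "reversible_matrices \<pi> =
    {P \<in> transition_matrices. \<forall>x y. pmf \<pi> x * P $ x $ y = pmf \<pi> y * P $ y $ x}"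

text \<open>Matrix powers; the overloaded \<open>^\<close> is not the power of the matrix product \<open>**\<close>.\<close>

primrec matrix_power :: "real ^ 'a ^ 'a::finite \<Rightarrow> nat \<Rightarrow> real ^ 'a ^ 'a" where
  "matrix_power P 0 = mat 1"
| "matrix_power P (Suc n) = P ** matrix_power P n"

definition irreducible_chain :: "real ^ 'a ^ 'a::finite \<Rightarrow> bool" where
  "irreducible_chain P \<longleftrightarrow> (\<forall>x y. \<exists>n. 0 < matrix_power P n $ x $ y)"

definition aperiodic_chain :: "real ^ 'a ^ 'a::finite \<Rightarrow> bool" where
  "aperiodic_chain P \<longleftrightarrow> (\<forall>x. Gcd {n. 1 \<le> n \<and> 0 < matrix_power P n $ x $ x} = 1)"

definition ergodic_chain :: "real ^ 'a ^ 'a::finite \<Rightarrow> bool" where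
  "ergodic_chain P \<longleftrightarrow> irreducible_chain P \<and> aperiodic_chain P"

definition pi_adjoint :: "'a::finite pmf \<Rightarrow> real ^ 'a ^ 'a \<Rightarrow> real ^ 'a ^ 'a" where
  "pi_adjoint \<pi> M = (\<chi> x y. pmf \<pi> y / pmf \<pi> x * M $ y $ x)"

definition isometric_involutions :: "'a::finite pmf \<Rightarrow> (real ^ 'a ^ 'a) set" where
  "isometric_involutions \<pi> = {Q. Q ** Q = mat 1 \<and> pi_adjoint \<pi> Q = Q}"

definition pi_inner :: "'a::finite pmf \<Rightarrow> real ^ 'a \<Rightarrow> real ^ 'a \<Rightarrow> real" where
  "pi_inner \<pi> f g = (\<Sum>x\<in>UNIV. f $ x * g $ x * pmf \<pi> x)"

definition ell2_0 :: "'a::finite pmf \<Rightarrow> (real ^ 'a) set" where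
  "ell2_0 \<pi> = {f. (\<Sum>x\<in>UNIV. pmf \<pi> x * f $ x) = 0}"

definition pi_matrix :: "'a::finite pmf \<Rightarrow> real ^ 'a ^ 'a" where
  "pi_matrix \<pi> = (\<chi> x y. pmf \<pi> y)"

text \<open>The next two functions are total, but meaningful only when \<open>P\<close> is an ergodic transition
  matrix with stationary distribution \<open>\<pi>\<close>: then the matrix below is invertible, and
  \<open>matrix_inv\<close> is its inverse.\<close>

definition fundamental_matrix :: "'a::finite pmf \<Rightarrow> real ^ 'a ^ 'a \<Rightarrow> real ^ 'a ^ 'a" where
  "fundamental_matrix \<pi> P = matrix_inv (mat 1 - (P - pi_matrix \<pi>))"

definition asym_var :: "'a::finite pmf \<Rightarrow> real ^ 'a \<Rightarrow> real ^ 'a ^ 'a \<Rightarrow> real" where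
  "asym_var \<pi> f P = 2 * pi_inner \<pi> f (fundamental_matrix \<pi> P *v f) - pi_inner \<pi> f f"

definition P_bar_alpha :: "real \<Rightarrow> real ^ 'a ^ 'a::finite \<Rightarrow> real ^ 'a ^ 'a \<Rightarrow> real ^ 'a ^ 'a" where
  "P_bar_alpha \<alpha> P Q = \<alpha> *\<^sub>R P + (1 - \<alpha>) *\<^sub>R (Q ** P ** Q)"

definition P_bar :: "real ^ 'a ^ 'a::finite \<Rightarrow> real ^ 'a ^ 'a \<Rightarrow> real ^ 'a ^ 'a" where
  "P_bar P Q = (1 / 2) *\<^sub>R (P + Q ** P ** Q)"

text \<open>\<open>m = min S\<close> with the minimum attained, for possibly infinite \<open>S\<close> (where \<open>Min\<close> is
  unspecified).\<close>

definition is_minimum :: "real set \<Rightarrow> real \<Rightarrow> bool" where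
  "is_minimum S m \<longleftrightarrow> m \<in> S \<and> (\<forall>s\<in>S. m \<le> s)"

end

theory Submission
  imports Defs
begin

text \<open>With \<open>A(P) = I - P + \<Pi>\<close>, the Dirichlet form shows that \<open>A(P)\<close> is self-adjoint and
  positive definite for \<open>\<langle>\<cdot>,\<cdot>\<rangle>\<^sub>\<pi>\<close>, and \<open>A(QPQ) = Q A(P) Q\<close>. The inequality is the convexity of
  \<open>M \<mapsto> \<langle>f, M\<inverse> f\<rangle>\<^sub>\<pi>\<close>, which is a maximum over \<open>g\<close> of the functions
  \<open>2\<langle>f,g\<rangle>\<^sub>\<pi> - \<langle>g, M g\<rangle>\<^sub>\<pi>\<close>, affine in \<open>M\<close>. The minimum is at \<open>\<alpha> = 1/2\<close> because averaging
  \<open>P\<^sub>\<alpha>\<close> with \<open>Q P\<^sub>\<alpha> Q\<close> gives \<open>(P + QPQ)/2\<close>, for every \<open>\<alpha>\<close>.\<close>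

section \<open>The weighted inner product and positive definite matrices\<close>

lemma pi_inner_commute: "pi_inner \<pi> f g = pi_inner \<pi> g f"
  by (simp add: pi_inner_def mult.commute)

lemma pi_inner_linear:
  "pi_inner \<pi> f (g + h) = pi_inner \<pi> f g + pi_inner \<pi> f h"
  "pi_inner \<pi> f (g - h) = pi_inner \<pi> f g - pi_inner \<pi> f h"
  "pi_inner \<pi> f (c *\<^sub>R g) = c * pi_inner \<pi> f g"
  "pi_inner \<pi> (g + h) f = pi_inner \<pi> g f + pi_inner \<pi> h f"
  "pi_inner \<pi> (g - h) f = pi_inner \<pi> g f - pi_inner \<pi> h f"
  "pi_inner \<pi> (c *\<^sub>R g) f = c * pi_inner \<pi> g f"
  by (simp_all add: pi_inner_def algebra_simps sum.distrib sum_subtractf sum_distrib_left)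

definition pi_positive_definite :: "'a::finite pmf \<Rightarrow> real ^ 'a ^ 'a \<Rightarrow> bool" where
  "pi_positive_definite \<pi> M \<longleftrightarrow>
    (\<forall>f g. pi_inner \<pi> f (M *v g) = pi_inner \<pi> (M *v f) g) \<and>
    (\<forall>g. g \<noteq> 0 \<longrightarrow> 0 < pi_inner \<pi> g (M *v g))"

lemma pi_positive_definite_nonneg:
  "pi_positive_definite \<pi> M \<Longrightarrow> 0 \<le> pi_inner \<pi> g (M *v g)"
  by (cases "g = 0") (auto simp: pi_positive_definite_def pi_inner_def less_imp_le)

text \<open>A positive quadratic form forces a trivial kernel, and a square matrix with trivial
  kernel is invertible. As \<open>matrix_inv\<close> is a choice operator, the inverse equation has
  to be extracted from invertibility.\<close>

lemma pi_positive_definite_matrix_inv: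
  assumes "pi_positive_definite \<pi> M"
  shows "M *v (matrix_inv M *v f) = f"
proof -
  have "M *v g = 0 \<longrightarrow> g = 0" for g
    using assms by (force simp: pi_positive_definite_def pi_inner_def)
  then have "invertible M"
    using matrix_left_invertible_ker invertible_left_inverse by blast
  then have "M ** matrix_inv M = mat 1"
    unfolding invertible_def matrix_inv_def by (rule someI2_ex) simp
  then show ?thesis
    by (simp add: matrix_vector_mul_assoc)
qed

text \<open>Completing the square: with h = M^-1 f, the right side minus the left side is the form
  of M at g - h. Equality at g = h makes h the maximizer.\<close>

lemma pi_positive_definite_variational:
  assumes "pi_positive_definite \<pi> M"
  shows "2 * pi_inner \<pi> f g - pi_inner \<pi> g (M *v g) \<le> pi_inner \<pi> f (matrix_inv M *v f)"
proof -
  define h where "h = matrix_inv M *v f"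
  have Mh: "M *v h = f"
    unfolding h_def by (rule pi_positive_definite_matrix_inv[OF assms])
  have sym: "pi_inner \<pi> h (M *v g) = pi_inner \<pi> f g"
    using assms Mh by (simp add: pi_positive_definite_def)
  have "0 \<le> pi_inner \<pi> (g - h) (M *v (g - h))"
    by (rule pi_positive_definite_nonneg[OF assms])
  also have "\<dots> = pi_inner \<pi> g (M *v g) - 2 * pi_inner \<pi> f g + pi_inner \<pi> f h"
    by (simp add: matrix_vector_mult_diff_distrib pi_inner_linear Mh sym pi_inner_commute[of \<pi> _ f])
  finally show ?thesis
    by (simp add: h_def)
qed

text \<open>The form of QMQ at g is the form of M at Qg, and Qg is nonzero when g is, because Q is
  its own inverse.\<close>

lemma pi_positive_definite_conj:
  assumes "pi_positive_definite \<pi> M"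
    and "\<And>f g. pi_inner \<pi> f (Q *v g) = pi_inner \<pi> (Q *v f) g" and "Q ** Q = mat 1"
  shows "pi_positive_definite \<pi> (Q ** M ** Q)"
proof -
  have "Q *v g \<noteq> 0" if "g \<noteq> 0" for g
    using that assms(3) by (metis matrix_vector_mul_assoc matrix_vector_mul_lid matrix_vector_mult_0_right)
  moreover have "pi_inner \<pi> f ((Q ** M ** Q) *v g) = pi_inner \<pi> (Q *v f) (M *v (Q *v g))"
    and "pi_inner \<pi> ((Q ** M ** Q) *v f) g = pi_inner \<pi> (M *v (Q *v f)) (Q *v g)" for f g
    by (simp_all only: matrix_vector_mul_assoc[symmetric] assms(2))
  ultimately show ?thesis
    using assms(1) unfolding pi_positive_definite_def by metis
qed

lemma pi_positive_definite_convex: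
  assumes "pi_positive_definite \<pi> A" "pi_positive_definite \<pi> B" "0 \<le> a" "a \<le> 1"
  shows "pi_positive_definite \<pi> (a *\<^sub>R A + (1 - a) *\<^sub>R B)"
proof -
  have "0 < a * pi_inner \<pi> g (A *v g) + (1 - a) * pi_inner \<pi> g (B *v g)" if "g \<noteq> 0" for g
  \<comment> \<open>Strict positivity comes from B alone when a = 0, and from A otherwise, where B
    need only contribute a nonnegative term.\<close>
  proof (cases "a = 0")
    case False
    with assms that have "0 < a * pi_inner \<pi> g (A *v g)" "0 \<le> (1 - a) * pi_inner \<pi> g (B *v g)"
      using pi_positive_definite_nonneg[OF assms(2)] by (auto simp: pi_positive_definite_def)
    then show ?thesis by linarith
  qed (use assms that in \<open>auto simp: pi_positive_definite_def\<close>)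
  then show ?thesis
    using assms(1,2) unfolding pi_positive_definite_def
    by (simp add: matrix_vector_mult_add_rdistrib scaleR_matrix_vector_assoc[symmetric] pi_inner_linear)
qed

section \<open>Matrix algebra and self-adjointness from detailed balance\<close>

lemma matrix_mult_linear:
  fixes A B C :: "real ^ 'a ^ 'a::finite"
  shows "A ** (B - C) = A ** B - A ** C" "(B - C) ** A = B ** A - C ** A"
    "(B + C) ** A = B ** A + C ** A" "A ** (c *\<^sub>R B) = c *\<^sub>R (A ** B)" "(c *\<^sub>R B) ** A = c *\<^sub>R (B ** A)"
  by (simp_all add: vec_eq_iff matrix_matrix_mult_def algebra_simps sum_subtractf sum.distrib
      sum_distrib_left)

lemma pi_inner_self_adjoint:
  assumes "\<And>x y. pmf \<pi> x * M $ x $ y = pmf \<pi> y * M $ y $ x"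
  shows "pi_inner \<pi> f (M *v g) = pi_inner \<pi> (M *v f) g"
proof -
  have "pi_inner \<pi> f (M *v g) = (\<Sum>x\<in>UNIV. \<Sum>y\<in>UNIV. f $ x * g $ y * (pmf \<pi> x * M $ x $ y))"
    by (simp add: pi_inner_def matrix_vector_mult_def sum_distrib_left sum_distrib_right mult_ac)
  also have "\<dots> = (\<Sum>x\<in>UNIV. \<Sum>y\<in>UNIV. f $ x * g $ y * (pmf \<pi> y * M $ y $ x))"
    by (intro sum.cong refl arg_cong2[where f = "(*)"] assms)
  also have "\<dots> = (\<Sum>y\<in>UNIV. \<Sum>x\<in>UNIV. f $ x * g $ y * (pmf \<pi> y * M $ y $ x))"
    by (rule sum.swap)
  also have "\<dots> = pi_inner \<pi> (M *v f) g"
    by (simp add: pi_inner_def matrix_vector_mult_def sum_distrib_left sum_distrib_right mult_ac)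
  finally show ?thesis .
qed

text \<open>Full support makes the division by \<pi>(x) in \<open>pi_adjoint\<close> a genuine one,
  so the denominator can be cleared.\<close>

lemma isometric_involution_balance:
  assumes "set_pmf \<pi> = UNIV" "Q \<in> isometric_involutions \<pi>"
  shows "pmf \<pi> x * Q $ x $ y = pmf \<pi> y * Q $ y $ x"
proof -
  have "0 < pmf \<pi> x"
    using assms(1) by (simp add: pmf_positive)
  moreover have "pi_adjoint \<pi> Q $ x $ y = Q $ x $ y"
    using assms(2) by (simp add: isometric_involutions_def)
  ultimately show ?thesis
    by (simp add: pi_adjoint_def field_simps)
qed

lemmas isometric_involution_self_adjoint =
  pi_inner_self_adjoint[OF isometric_involution_balance]

section \<open>The matrix I - P + \<Pi> and the Dirichlet form\<close>

definition fundamental_inverse :: "'a::finite pmf \<Rightarrow> real ^ 'a ^ 'a \<Rightarrow> real ^ 'a ^ 'a" where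
  "fundamental_inverse \<pi> P = mat 1 - (P - pi_matrix \<pi>)"

lemma asym_var_fundamental_inverse:
  "asym_var \<pi> f P = 2 * pi_inner \<pi> f (matrix_inv (fundamental_inverse \<pi> P) *v f) - pi_inner \<pi> f f"
  by (simp add: asym_var_def fundamental_matrix_def fundamental_inverse_def)

text \<open>Equality along single transitions propagates along paths of positive probability, and
  these join any two states. This identifies the functions of zero Dirichlet energy as the
  constants.\<close>

lemma irreducible_chain_constant:
  assumes "\<And>x y. 0 \<le> P $ x $ y" "irreducible_chain P"
    and step: "\<And>x y. 0 < P $ x $ y \<Longrightarrow> f x = f y"
  shows "f x = f y"
proof -
  have nn: "0 \<le> matrix_power P n $ x $ y" for n x y
    by (induction n arbitrary: x y)
       (auto simp: mat_def matrix_matrix_mult_def assms(1) intro!: sum_nonneg)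
  have "0 < matrix_power P n $ x $ y \<Longrightarrow> f x = f y" for n x y
  proof (induction n arbitrary: x)
    case 0
    then show ?case by (auto simp: mat_def split: if_splits)
  next
    case (Suc n)
    then have "(\<Sum>z\<in>UNIV. P $ x $ z * matrix_power P n $ z $ y) \<noteq> 0"
      by (simp add: matrix_matrix_mult_def)
    then obtain z where "P $ x $ z * matrix_power P n $ z $ y \<noteq> 0"
      by (meson sum.neutral)
    \<comment> \<open>Both factors are nonnegative, so a nonzero product makes both
      positive.\<close>
    then have "0 < P $ x $ z" "0 < matrix_power P n $ z $ y"
      using assms(1)[of x z] nn[of n z y] by auto
    then show ?case using Suc.IH step by metis
  qed
  then show ?thesis
    using assms(2) unfolding irreducible_chain_def by blast
qed

text \<open>Expanding the square leaves two diagonal sums and a cross term. The diagonal sums agree: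
  one collapses by the unit row sums, the other reduces to it by reversibility and a swap of
  indices.\<close>

lemma dirichlet_form:
  assumes "P \<in> reversible_matrices \<pi>"
  shows "pi_inner \<pi> f (f - P *v f) =
    (\<Sum>x\<in>UNIV. \<Sum>y\<in>UNIV. pmf \<pi> x * P $ x $ y * (f $ x - f $ y)\<^sup>2) / 2"
proof -
  have row: "(\<Sum>y\<in>UNIV. P $ x $ y) = 1" for x
    using assms by (simp add: reversible_matrices_def transition_matrices_def)
  have bal: "pmf \<pi> x * P $ x $ y = pmf \<pi> y * P $ y $ x" for x y
    using assms by (simp add: reversible_matrices_def)
  define S where "S = (\<Sum>x\<in>UNIV. pmf \<pi> x * (f $ x)\<^sup>2)"
  define T where "T = (\<Sum>x\<in>UNIV. \<Sum>y\<in>UNIV. pmf \<pi> x * P $ x $ y * (f $ x * f $ y))"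
  have 1: "(\<Sum>x\<in>UNIV. \<Sum>y\<in>UNIV. pmf \<pi> x * P $ x $ y * (f $ x)\<^sup>2) = S"
    by (simp add: S_def sum_distrib_left[symmetric] sum_distrib_right[symmetric] row)
  have "(\<Sum>x\<in>UNIV. \<Sum>y\<in>UNIV. pmf \<pi> x * P $ x $ y * (f $ y)\<^sup>2) =
      (\<Sum>x\<in>UNIV. \<Sum>y\<in>UNIV. pmf \<pi> y * P $ y $ x * (f $ y)\<^sup>2)"
    by (simp add: bal)
  also have "\<dots> = S"
    by (subst sum.swap) (rule 1)
  finally have 2: "(\<Sum>x\<in>UNIV. \<Sum>y\<in>UNIV. pmf \<pi> x * P $ x $ y * (f $ y)\<^sup>2) = S" .
  have "(\<Sum>x\<in>UNIV. \<Sum>y\<in>UNIV. pmf \<pi> x * P $ x $ y * (f $ x - f $ y)\<^sup>2) =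
     (\<Sum>x\<in>UNIV. \<Sum>y\<in>UNIV. pmf \<pi> x * P $ x $ y * (f $ x)\<^sup>2
        + pmf \<pi> x * P $ x $ y * (f $ y)\<^sup>2 - 2 * (pmf \<pi> x * P $ x $ y * (f $ x * f $ y)))"
    by (simp add: power2_eq_square algebra_simps)
  also have "\<dots> = S + S - 2 * T"
    by (simp add: sum.distrib sum_subtractf 1 2 T_def sum_distrib_left)
  also have "\<dots> = 2 * pi_inner \<pi> f (f - P *v f)"
    unfolding pi_inner_def S_def T_def matrix_vector_mult_def
    by (simp add: sum_subtractf sum_distrib_left algebra_simps power2_eq_square)
  finally show ?thesis by simp
qed

lemma pi_matrix_mult: "pi_matrix \<pi> *v f = (\<chi> x. \<Sum>y\<in>UNIV. pmf \<pi> y * f $ y)"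
  by (simp add: pi_matrix_def matrix_vector_mult_def)

lemma pi_inner_pi_matrix:
  "pi_inner \<pi> f (pi_matrix \<pi> *v f) = (\<Sum>y\<in>UNIV. pmf \<pi> y * f $ y)\<^sup>2"
  by (simp add: pi_inner_def pi_matrix_mult power2_eq_square sum_distrib_left sum_distrib_right mult_ac)

text \<open>The form at g is the Dirichlet energy plus the squared mean. Zero energy makes g
  constant by irreducibility, and zero mean then makes that constant 0: \<Pi> removes exactly the
  kernel of I - P.\<close>

lemma fundamental_inverse_positive_definite:
  assumes full: "set_pmf \<pi> = UNIV"
    and P: "P \<in> reversible_matrices \<pi>" and irr: "irreducible_chain P"
  shows "pi_positive_definite \<pi> (fundamental_inverse \<pi> P)"
  unfolding pi_positive_definite_def
proof (intro conjI allI impI)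
  have pos: "0 < pmf \<pi> x" for x
    using full by (simp add: pmf_positive)
  have nn: "0 \<le> P $ x $ y" for x y
    using P by (simp add: reversible_matrices_def transition_matrices_def)
  show "pi_inner \<pi> f (fundamental_inverse \<pi> P *v g) = pi_inner \<pi> (fundamental_inverse \<pi> P *v f) g" for f g
    by (rule pi_inner_self_adjoint)
       (use P in \<open>auto simp: fundamental_inverse_def reversible_matrices_def pi_matrix_def mat_def algebra_simps\<close>)
  fix g :: "real ^ 'a" assume "g \<noteq> 0"
  define D where "D = (\<Sum>x\<in>UNIV. \<Sum>y\<in>UNIV. pmf \<pi> x * P $ x $ y * (g $ x - g $ y)\<^sup>2)"
  define m where "m = (\<Sum>y\<in>UNIV. pmf \<pi> y * g $ y)"
  have eq: "pi_inner \<pi> g (fundamental_inverse \<pi> P *v g) = D / 2 + m\<^sup>2"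
  proof -
    have "pi_inner \<pi> g (fundamental_inverse \<pi> P *v g) =
        pi_inner \<pi> g (g - P *v g) + pi_inner \<pi> g (pi_matrix \<pi> *v g)"
      by (simp add: fundamental_inverse_def matrix_vector_mult_diff_rdistrib pi_inner_linear)
    then show ?thesis
      unfolding D_def m_def by (simp only: dirichlet_form[OF P] pi_inner_pi_matrix)
  qed
  have D: "0 \<le> D"
    unfolding D_def by (intro sum_nonneg mult_nonneg_nonneg nn zero_le_power2) auto
  show "0 < pi_inner \<pi> g (fundamental_inverse \<pi> P *v g)"
  proof (rule ccontr)
    assume "\<not> ?thesis"
    with eq D zero_le_power2[of m] have "D = 0 \<and> m\<^sup>2 = 0"
      by linarith
    then have D0: "D = 0" and m0: "m = 0"
      by auto
    \<comment> \<open>A vanishing sum of nonnegative terms has only zero terms; this is applied to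
      the outer and then to the inner sum.\<close>
    from D0 have "pmf \<pi> x * P $ x $ y * (g $ x - g $ y)\<^sup>2 = 0" for x y
      unfolding D_def
      by (subst (asm) sum_nonneg_eq_0_iff, simp, force intro!: sum_nonneg simp: nn,
          subst (asm) sum_nonneg_eq_0_iff, auto simp: nn)
    then have step: "g $ x = g $ y" if "0 < P $ x $ y" for x y
      using that pos[of x] by (metis less_irrefl mult_eq_0_iff power2_eq_iff_nonneg right_minus_eq zero_eq_power2)
    have const: "g $ x = g $ y" for x y
      by (rule irreducible_chain_constant[OF nn irr step])
    have "g $ x = 0" for x
    proof -
      \<comment> \<open>The mean of a constant function is its value, as \<pi> has total mass
        1.\<close>
      have "m = (\<Sum>y\<in>UNIV. pmf \<pi> y) * g $ x"
        unfolding m_def sum_distrib_right by (rule sum.cong[OF refl]) (use const in metis)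
      then show ?thesis
        using m0 by (simp add: sum_pmf_eq_1)
    qed
    with \<open>g \<noteq> 0\<close> show False by (simp add: vec_eq_iff)
  qed
qed

section \<open>Conjugation by Q and the convexity inequality\<close>

lemma fundamental_inverse_conj:
  assumes "set_pmf \<pi> = UNIV" "Q \<in> isometric_involutions \<pi>" "Q \<in> transition_matrices"
  shows "fundamental_inverse \<pi> (Q ** P ** Q) = Q ** fundamental_inverse \<pi> P ** Q"
proof -
  have row: "(\<Sum>y\<in>UNIV. Q $ x $ y) = 1" for x
    using assms(3) by (simp add: transition_matrices_def)
  have "Q ** pi_matrix \<pi> = pi_matrix \<pi>"
    by (simp add: vec_eq_iff matrix_matrix_mult_def pi_matrix_def sum_distrib_right[symmetric] row)
  \<comment> \<open>Detailed balance turns the \<pi>-weighted column sum of Q into \<pi>(y) times a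
    row sum.\<close>
  moreover have "pi_matrix \<pi> ** Q = pi_matrix \<pi>"
    by (simp add: vec_eq_iff matrix_matrix_mult_def pi_matrix_def sum_distrib_left[symmetric] row
        isometric_involution_balance[OF assms(1,2)])
  moreover have "Q ** Q = mat 1"
    using assms(2) by (simp add: isometric_involutions_def)
  ultimately show ?thesis
    by (simp add: fundamental_inverse_def matrix_mult_linear)
qed

text \<open>The weights add up to 1, so the fixed part I + \<Pi> splits along with P and
  QPQ.\<close>

lemma fundamental_inverse_P_bar_alpha:
  assumes "set_pmf \<pi> = UNIV" "Q \<in> isometric_involutions \<pi>" "Q \<in> transition_matrices"
  shows "fundamental_inverse \<pi> (P_bar_alpha \<alpha> P Q) =
    \<alpha> *\<^sub>R fundamental_inverse \<pi> P + (1 - \<alpha>) *\<^sub>R (Q ** fundamental_inverse \<pi> P ** Q)"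
  unfolding fundamental_inverse_conj[OF assms, symmetric]
  by (simp add: fundamental_inverse_def P_bar_alpha_def algebra_simps)

text \<open>P enters only through positive definiteness, and the first conclusion returns that
  property for \<open>P_bar_alpha \<alpha> P Q\<close>. The inequality can thus be applied a second
  time, starting from \<open>P_bar_alpha \<alpha> P Q\<close>.\<close>

lemma asym_var_P_bar_alpha_le:
  assumes full: "set_pmf \<pi> = UNIV"
    and Q: "Q \<in> isometric_involutions \<pi>" "Q \<in> transition_matrices"
    and pd: "pi_positive_definite \<pi> (fundamental_inverse \<pi> P)"
    and \<alpha>: "\<alpha> \<in> {0..1}"
  shows "pi_positive_definite \<pi> (fundamental_inverse \<pi> (P_bar_alpha \<alpha> P Q))"
    and "asym_var \<pi> f (P_bar_alpha \<alpha> P Q) \<le>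
      \<alpha> * asym_var \<pi> f P + (1 - \<alpha>) * asym_var \<pi> (Q *v f) P"
proof -
  define A where "A = fundamental_inverse \<pi> P"
  define C where "C = fundamental_inverse \<pi> (P_bar_alpha \<alpha> P Q)"
  note sa = isometric_involution_self_adjoint[OF full Q(1)]
  have QQ: "Q ** Q = mat 1"
    using Q(1) by (simp add: isometric_involutions_def)
  have QQv: "Q *v (Q *v h) = h" for h
    by (simp add: matrix_vector_mul_assoc QQ)
  have C_eq: "C = \<alpha> *\<^sub>R A + (1 - \<alpha>) *\<^sub>R (Q ** A ** Q)"
    unfolding A_def C_def by (rule fundamental_inverse_P_bar_alpha[OF full Q])
  show pdC: "pi_positive_definite \<pi> (fundamental_inverse \<pi> (P_bar_alpha \<alpha> P Q))"
    unfolding C_def[symmetric] C_eq A_def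
    using \<alpha> by (intro pi_positive_definite_convex pi_positive_definite_conj pd sa QQ) auto
  \<comment> \<open>The maximizer of the variational problem for C serves as trial vector in the
    problems for A and QAQ.\<close>
  define g where "g = matrix_inv C *v f"
  have Cg: "C *v g = f"
    unfolding g_def C_def by (rule pi_positive_definite_matrix_inv[OF pdC])
  have iso: "pi_inner \<pi> (Q *v h) (Q *v k) = pi_inner \<pi> h k" for h k
    by (simp add: sa[symmetric] QQv)
  have 1: "\<alpha> * (2 * pi_inner \<pi> f g - pi_inner \<pi> g (A *v g)) \<le>
      \<alpha> * pi_inner \<pi> f (matrix_inv A *v f)"
    unfolding A_def
    using \<alpha> by (intro mult_left_mono pi_positive_definite_variational[OF pd]) auto
  \<comment> \<open>The problem for QAQ with data f and trial g is the problem for A with data Qf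
    and trial Qg.\<close>
  have 2: "(1 - \<alpha>) * (2 * pi_inner \<pi> (Q *v f) (Q *v g) - pi_inner \<pi> (Q *v g) (A *v (Q *v g))) \<le>
      (1 - \<alpha>) * pi_inner \<pi> (Q *v f) (matrix_inv A *v (Q *v f))"
    unfolding A_def
    using \<alpha> by (intro mult_left_mono pi_positive_definite_variational[OF pd]) auto
  \<comment> \<open>Since Cg = f, the quadratic terms of the two bounds add up to
    \<langle>g,f\<rangle>. Their left sides therefore total 2\<langle>f,g\<rangle> -
    \<langle>g,f\<rangle> = \<langle>f,g\<rangle>.\<close>
  have "pi_inner \<pi> g f = \<alpha> * pi_inner \<pi> g (A *v g) + (1 - \<alpha>) * pi_inner \<pi> (Q *v g) (A *v (Q *v g))"
    unfolding Cg[symmetric] C_eq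
    by (simp add: matrix_vector_mult_add_rdistrib scaleR_matrix_vector_assoc[symmetric]
        pi_inner_linear matrix_vector_mul_assoc[symmetric] sa)
  with 1 2 have "pi_inner \<pi> f g \<le> \<alpha> * pi_inner \<pi> f (matrix_inv A *v f) +
      (1 - \<alpha>) * pi_inner \<pi> (Q *v f) (matrix_inv A *v (Q *v f))"
    by (simp add: iso pi_inner_commute[of \<pi> g f] algebra_simps)
  \<comment> \<open>The subtracted norms match because Q is an isometry: \<langle>Qf,Qf\<rangle> =
    \<langle>f,f\<rangle>.\<close>
  then show "asym_var \<pi> f (P_bar_alpha \<alpha> P Q) \<le>
      \<alpha> * asym_var \<pi> f P + (1 - \<alpha>) * asym_var \<pi> (Q *v f) P"
    unfolding asym_var_fundamental_inverse A_def[symmetric] C_def[symmetric] g_def[symmetric] iso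
    by (simp add: algebra_simps)
qed

section \<open>Invariance under sign change and the minimum at \<alpha> = 1/2\<close>

lemma asym_var_minus: "asym_var \<pi> (- f) P = asym_var \<pi> f P"
  using matrix_vector_mult_diff_distrib[of "fundamental_matrix \<pi> P" 0 f]
  by (simp add: asym_var_def pi_inner_def)

lemma P_bar_eq_P_bar_alpha_half: "P_bar P Q = P_bar_alpha (1 / 2) P Q"
  by (simp add: P_bar_def P_bar_alpha_def algebra_simps)

text \<open>Since Q^2 = I, conjugation by Q exchanges P and QPQ and hence the weights \<alpha> and 1
  - \<alpha>, which cancel in the average.\<close>

lemma P_bar_P_bar_alpha:
  assumes "Q ** Q = mat 1"
  shows "P_bar (P_bar_alpha \<alpha> P Q) Q = P_bar P Q"
proof -
  have "Q ** (Q ** P ** Q) ** Q = (Q ** Q) ** P ** (Q ** Q)"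
    by (simp only: matrix_mul_assoc)
  then have "Q ** P_bar_alpha \<alpha> P Q ** Q = \<alpha> *\<^sub>R (Q ** P ** Q) + (1 - \<alpha>) *\<^sub>R P"
    by (simp add: P_bar_alpha_def assms matrix_add_ldistrib matrix_mult_linear)
  then have "P_bar_alpha \<alpha> P Q + Q ** P_bar_alpha \<alpha> P Q ** Q = P + Q ** P ** Q"
    by (simp add: P_bar_alpha_def scaleR_left_diff_distrib)
  then show ?thesis
    by (simp add: P_bar_def)
qed

theorem proposition3p6:
  fixes \<pi> :: "'a::finite pmf" and P Q :: "real ^ 'a ^ 'a"
  assumes "set_pmf \<pi> = UNIV"
    and "P \<in> reversible_matrices \<pi>" and "ergodic_chain P"
    and "Q \<in> isometric_involutions \<pi> \<inter> transition_matrices"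
  shows "\<forall>f \<in> ell2_0 \<pi>.
    (\<forall>\<alpha>\<in>{0..1}. asym_var \<pi> f (P_bar_alpha \<alpha> P Q)
        \<le> \<alpha> * asym_var \<pi> f P + (1 - \<alpha>) * asym_var \<pi> (Q *v f) P) \<and>
    (Q *v f = f \<or> Q *v f = - f \<longrightarrow>
      (\<forall>\<alpha>\<in>{0..1}. asym_var \<pi> f (P_bar_alpha \<alpha> P Q) \<le> asym_var \<pi> f P) \<and>
      is_minimum ((\<lambda>\<alpha>. asym_var \<pi> f (P_bar_alpha \<alpha> P Q)) ` {0..1})
        (asym_var \<pi> f (P_bar P Q)))"
proof (intro ballI conjI impI)
  have Q: "Q \<in> isometric_involutions \<pi>" "Q \<in> transition_matrices"
    using assms(4) by auto
  have QQ: "Q ** Q = mat 1"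
    using Q(1) by (simp add: isometric_involutions_def)
  have pd: "pi_positive_definite \<pi> (fundamental_inverse \<pi> P)"
    using assms by (intro fundamental_inverse_positive_definite) (auto simp: ergodic_chain_def)
  note le = asym_var_P_bar_alpha_le[OF assms(1) Q]
  fix f :: "real ^ 'a"
  show "asym_var \<pi> f (P_bar_alpha \<alpha> P Q)
      \<le> \<alpha> * asym_var \<pi> f P + (1 - \<alpha>) * asym_var \<pi> (Q *v f) P" if "\<alpha> \<in> {0..1}" for \<alpha>
    by (rule le(2)[OF pd that])
  assume "Q *v f = f \<or> Q *v f = - f"
  then have inv: "asym_var \<pi> (Q *v f) R = asym_var \<pi> f R" for R
    by (auto simp: asym_var_minus)
  \<comment> \<open>R is left general: it is P for the upper bound and
    \<open>P_bar_alpha \<alpha> P Q\<close> for the minimum.\<close>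
  have le': "asym_var \<pi> f (P_bar_alpha \<alpha> R Q) \<le> asym_var \<pi> f R"
    if "pi_positive_definite \<pi> (fundamental_inverse \<pi> R)" "\<alpha> \<in> {0..1}" for \<alpha> R
    using le(2)[OF that, of f] by (simp add: inv algebra_simps)
  show "asym_var \<pi> f (P_bar_alpha \<alpha> P Q) \<le> asym_var \<pi> f P" if "\<alpha> \<in> {0..1}" for \<alpha>
    by (rule le'[OF pd that])
  \<comment> \<open>Parameter 1/2 applied to \<open>P_bar_alpha \<alpha> P Q\<close> produces
    \<open>P_bar P Q\<close>, whatever \<alpha> is.\<close>
  have "asym_var \<pi> f (P_bar P Q) \<le> asym_var \<pi> f (P_bar_alpha \<alpha> P Q)" if "\<alpha> \<in> {0..1}" for \<alpha>
    using le'[OF le(1)[OF pd that], of "1 / 2"]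
    by (simp add: P_bar_eq_P_bar_alpha_half[symmetric] P_bar_P_bar_alpha[OF QQ])
  then show "is_minimum ((\<lambda>\<alpha>. asym_var \<pi> f (P_bar_alpha \<alpha> P Q)) ` {0..1})
      (asym_var \<pi> f (P_bar P Q))"
    unfolding is_minimum_def P_bar_eq_P_bar_alpha_half by auto
qed

end
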